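(* Let $d \ge 1$ and let $\mathbf{S}_1, \ldots, \mathbf{S}_{d+1} \subset \mathbb{R}^d$ be pairwise disjoint sets with $|\mathbf{S}_i| = d+1$ for each $i$. Let $p \in \mathbb{R}^d$ be a point with $p \notin \bigcup_i \mathbf{S}_i$, such that the points of $\bigcup_{i=1}^{d+1}\mathbf{S}_i \cup \{p\}$ are in general position and $p \in \operatorname{int}(\operatorname{conv}(\mathbf{S}_i))$ for every $i = 1, \ldots, d+1$. Then the number of colourful simplices containing $p$ is at least $\left\lceil \frac{(d+1)^2}{2} \right\rceil$. Equivalently, $\mu(d) \ge \left\lceil \frac{(d+1)^2}{2}\right\rceil$.
   Context: A colourful simplex is the closed simplex $\operatorname{conv}\{x_1, \ldots, x_{d+1}\}$ with $x_i \in \mathbf{S}_i$ for each $i$ (one vertex from each set $\mathbf{S}_i$); distinct choices of $(x_1,\dots,x_{d+1})$ count as distinct simplices. The quantity $\mu(d)$ denotes the minimum, over all such configurations (sets $\mathbf{S}_1,\dots,\mathbf{S}_{d+1}$ of $d+1$ points each and a point $p$ in general position with $p$ in the interior of each $\operatorname{conv}(\mathbf{S}_i)$), of the number of colourful simplices containing $p$. *)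

theory Defs
  imports "HOL-Analysis.Analysis" "HOL-Library.FuncSet"
begin

definition general_position :: "(real^'n) set \<Rightarrow> bool" where
  "general_position P \<longleftrightarrow>
     (\<forall>T \<subseteq> P. card T \<le> CARD('n) + 1 \<longrightarrow> \<not> affine_dependent T)"

text \<open>Colourful simplices (as vertex choice functions, colour classes indexed by
  0..d) whose closed convex hull contains p.\<close>
definition colourful_simplices_containing ::
    "(nat \<Rightarrow> (real^'n) set) \<Rightarrow> real^'n \<Rightarrow> (nat \<Rightarrow> real^'n) set" where
  "colourful_simplices_containing S p =
     {x \<in> Pi\<^sub>E {..CARD('n)} S. p \<in> convex hull (x ` {..CARD('n)})}"

end

theory Submission
  imports Defs
begin

text \<open>Choosing one point of each colour, the simplices that contain \<open>p\<close> are the edges of a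
  \<open>(d+1)\<close>-partite hypergraph. It has no isolated vertex (colourful Caratheodory theorem), and for
  \<open>x\<close>, \<open>y\<close> of one colour and an octahedron spanned by two disjoint transversals of the other
  colours, the numbers of transversals in the octahedron that form an edge with \<open>x\<close> and with \<open>y\<close>
  have the same parity.

  The bound is a consequence of these two facts alone. Let \<open>n = d + 1\<close>. Parity shows that two
  vertices of one colour with different links have degrees adding up to at least \<open>n\<close>. So all
  vertices of degree below \<open>n/2\<close> in a colour have the same link, of size \<open>m\<close> say, and the others
  have degree at least \<open>n - m\<close>. If some colour has at most \<open>n/2\<close> low vertices, summing degrees in
  that colour gives \<open>n\<^sup>2/2\<close> edges. Otherwise every colour has more than \<open>n/2\<close> low vertices; then no
  edge contains two of them, and choosing an edge at each low vertex gives more than \<open>n\<^sup>2/2\<close>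
  edges.\<close>

section \<open>Octahedral systems\<close>

text \<open>Members are \<open>undefined\<close> at \<open>i\<close>, so the links of all vertices
  of colour \<open>i\<close> lie in one common set and can be compared as sets.\<close>

definition link :: "'i set \<Rightarrow> ('i \<Rightarrow> 'a set) \<Rightarrow> ('i \<Rightarrow> 'a) set \<Rightarrow> 'i \<Rightarrow> 'a \<Rightarrow> ('i \<Rightarrow> 'a) set" where
  "link I V E i v = {s \<in> Pi\<^sub>E (I - {i}) V. s(i := v) \<in> E}"

text \<open>\<open>parity\<close> is the usual axiom that two vertices from each colour span an even
  number of edges, with the edges split by their vertex of colour \<open>i\<close>.\<close>

locale octahedral_system =
  fixes I :: "'i set" and V :: "'i \<Rightarrow> 'a set" and E :: "('i \<Rightarrow> 'a) set"
  assumes finite_I: "finite I"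
    and finite_V: "i \<in> I \<Longrightarrow> finite (V i)"
    and card_V: "i \<in> I \<Longrightarrow> card (V i) = card I"
    and E_sub: "E \<subseteq> Pi\<^sub>E I V"
    and no_isolated: "i \<in> I \<Longrightarrow> v \<in> V i \<Longrightarrow> \<exists>e\<in>E. e i = v"
    and parity: "i \<in> I \<Longrightarrow> x \<in> V i \<Longrightarrow> y \<in> V i \<Longrightarrow> x \<noteq> y \<Longrightarrow>
      t \<in> Pi\<^sub>E (I - {i}) V \<Longrightarrow> t' \<in> Pi\<^sub>E (I - {i}) V \<Longrightarrow> (\<And>j. j \<in> I - {i} \<Longrightarrow> t j \<noteq> t' j) \<Longrightarrow>
      even (card (link I V E i x \<inter> Pi\<^sub>E (I - {i}) (\<lambda>j. {t j, t' j}))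
          + card (link I V E i y \<inter> Pi\<^sub>E (I - {i}) (\<lambda>j. {t j, t' j})))"
begin

abbreviation lk :: "'i \<Rightarrow> 'a \<Rightarrow> ('i \<Rightarrow> 'a) set" where
  "lk \<equiv> link I V E"

abbreviation deg :: "'i \<Rightarrow> 'a \<Rightarrow> nat" where
  "deg i v \<equiv> card (lk i v)"

lemma finite_E: "finite E"
  using E_sub finite_I finite_V by (meson finite_PiE finite_subset)

lemma finite_link: "finite (lk i v)"
proof -
  have "finite (Pi\<^sub>E (I - {i}) V)"
    using finite_I finite_V by (intro finite_PiE) auto
  then show ?thesis unfolding link_def by simp
qed

lemma deg_eq:
  assumes "i \<in> I"
  shows "deg i v = card {e \<in> E. e i = v}"
proof -
  have "bij_betw (\<lambda>s. s(i := v)) (lk i v) {e \<in> E. e i = v}"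
  proof (rule bij_betw_byWitness[where f' = "\<lambda>e. e(i := undefined)"])
    show "\<forall>a\<in>lk i v. (a(i := v))(i := undefined) = a"
      by (auto simp: link_def PiE_def extensional_def)
    show "(\<lambda>e. e(i := undefined)) ` {e \<in> E. e i = v} \<subseteq> lk i v"
    proof
      fix s assume "s \<in> (\<lambda>e. e(i := undefined)) ` {e \<in> E. e i = v}"
      then obtain e where e: "e \<in> E" "e i = v" "s = e(i := undefined)" by auto
      then have "e \<in> Pi\<^sub>E I V" using E_sub by auto
      then show "s \<in> lk i v"
        using e by (auto simp: link_def PiE_def extensional_def Pi_def)
    qed
    show "\<forall>e\<in>{e \<in> E. e i = v}. (e(i := undefined))(i := v) = e"
      by auto
    show "(\<lambda>s. s(i := v)) ` lk i v \<subseteq> {e \<in> E. e i = v}"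
      unfolding link_def by fastforce
  qed
  then show ?thesis by (rule bij_betw_same_card)
qed

lemma sum_deg:
  assumes "i \<in> I"
  shows "(\<Sum>v\<in>V i. deg i v) = card E"
proof -
  have "card E = card (\<Union>v\<in>V i. {e \<in> E. e i = v})"
    by (rule arg_cong[where f = card]) (use E_sub assms in auto)
  also have "\<dots> = (\<Sum>v\<in>V i. card {e \<in> E. e i = v})"
    using finite_E finite_V assms by (intro card_UN_disjoint) auto
  finally show ?thesis using assms by (simp add: deg_eq)
qed

section \<open>Degrees of two vertices of one colour\<close>

text \<open>Enumerate every \<open>V j\<close> without \<open>t j\<close> and let \<open>g k\<close>
  take the \<open>k\<close>-th point of each colour: this gives \<open>card I - 1\<close> pairwise
  disjoint transversals, all disjoint from \<open>t\<close>.\<close>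

lemma parallel_class:
  assumes t: "t \<in> Pi\<^sub>E (I - {i}) V"
  shows "\<exists>g. (\<forall>k<card I - 1. g k \<in> Pi\<^sub>E (I - {i}) V \<and> (\<forall>j\<in>I - {i}. g k j \<noteq> t j)) \<and>
    (\<forall>j\<in>I - {i}. inj_on (\<lambda>k. g k j) {..<card I - 1})"
proof -
  have "\<exists>h. bij_betw h {..<card I - 1} (V j - {t j})" if j: "j \<in> I - {i}" for j
  proof -
    have "card (V j - {t j}) = card I - 1" "finite (V j - {t j})"
      using t j card_V[of j] finite_V[of j] by (auto simp: PiE_def Pi_def)
    then show ?thesis
      by (intro finite_same_card_bij) auto
  qed
  then obtain h where h: "\<And>j. j \<in> I - {i} \<Longrightarrow> bij_betw (h j) {..<card I - 1} (V j - {t j})"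
    by metis
  show ?thesis
  proof (intro exI[of _ "\<lambda>k. \<lambda>j\<in>I - {i}. h j k"] conjI allI impI ballI)
    fix k assume k: "k < card I - 1"
    show "(\<lambda>j\<in>I - {i}. h j k) \<in> Pi\<^sub>E (I - {i}) V"
      using bij_betwE[OF h] k by auto
    show "(\<lambda>j\<in>I - {i}. h j k) j \<noteq> t j" if "j \<in> I - {i}" for j
      using bij_betwE[OF h] k that by force
  next
    fix j assume "j \<in> I - {i}"
    then show "inj_on (\<lambda>k. (\<lambda>j\<in>I - {i}. h j k) j) {..<card I - 1}"
      using h[of j] by (auto simp: bij_betw_def)
  qed
qed

text \<open>If \<open>t\<close> covers \<open>x\<close> but not \<open>y\<close>, every octahedron on \<open>t\<close> and a transversal disjoint from it
  contains, by parity, a transversal other than \<open>t\<close> that covers \<open>x\<close> or \<open>y\<close>. The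
  \<open>card I - 1\<close> octahedra of a parallel class pairwise share only \<open>t\<close>.\<close>

lemma deg_add_ge:
  assumes i: "i \<in> I" and x: "x \<in> V i" and y: "y \<in> V i"
    and tx: "t \<in> lk i x" and ty: "t \<notin> lk i y"
  shows "card I \<le> deg i x + deg i y"
proof -
  have t: "t \<in> Pi\<^sub>E (I - {i}) V" using tx by (simp add: link_def)
  obtain g where gg: "\<forall>k<card I - 1. g k \<in> Pi\<^sub>E (I - {i}) V \<and> (\<forall>j\<in>I - {i}. g k j \<noteq> t j)"
    and ginj: "\<forall>j\<in>I - {i}. inj_on (\<lambda>k. g k j) {..<card I - 1}"
    using parallel_class[OF t] by (elim exE conjE)
  define B where "B k = Pi\<^sub>E (I - {i}) (\<lambda>j. {t j, g k j})" for k
  have tB: "t \<in> B k" for k using t by (auto simp: B_def PiE_def)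
  have "x \<noteq> y" using tx ty by auto
  \<comment> \<open>A disjoint sum, so that a transversal in both links counts twice and the size is
    \<open>deg i x - 1 + deg i y\<close>.\<close>
  define F where "F = (lk i x - {t}) <+> lk i y"
  have finF: "finite F" unfolding F_def using finite_link by auto
  \<comment> \<open>Without such a \<open>w\<close>, \<open>B k\<close> meets the link of
    \<open>x\<close> only in \<open>t\<close> and that of \<open>y\<close> not at all: an odd total.
    \<open>case_sum id id\<close> forgets the tag.\<close>
  have "\<exists>w\<in>F. case_sum id id w \<in> B k - {t}" if k: "k < card I - 1" for k
  proof (rule ccontr)
    assume no: "\<not> ?thesis"
    have "s \<notin> lk i x" if "s \<in> B k" "s \<noteq> t" for s
    proof
      assume "s \<in> lk i x"
      then have "Inl s \<in> F" using that by (auto simp: F_def)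
      moreover have "case_sum id id (Inl s :: _ + ('i \<Rightarrow> 'a)) \<in> B k - {t}" using that by simp
      ultimately show False using no by blast
    qed
    then have 1: "lk i x \<inter> B k = {t}" using tx tB by blast
    have "s \<notin> lk i y" if "s \<in> B k" for s
    proof
      assume s: "s \<in> lk i y"
      then have "Inr s \<in> F" by (auto simp: F_def)
      moreover have "case_sum id id (Inr s :: ('i \<Rightarrow> 'a) + _) \<in> B k - {t}" using that s ty by auto
      ultimately show False using no by blast
    qed
    then have 2: "lk i y \<inter> B k = {}" by blast
    have "even (card (lk i x \<inter> B k) + card (lk i y \<inter> B k))"
      unfolding B_def
    proof (rule parity[OF i x y \<open>x \<noteq> y\<close> t])
      show "g k \<in> Pi\<^sub>E (I - {i}) V" using gg k by simp
      show "t j \<noteq> g k j" if "j \<in> I - {i}" for j using gg k that by metis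
    qed
    then show False by (simp add: 1 2)
  qed
  then have "\<forall>k\<in>{..<card I - 1}. \<exists>w. w \<in> F \<and> case_sum id id w \<in> B k - {t}" by blast
  from bchoice[OF this] obtain w
    where w: "\<forall>k\<in>{..<card I - 1}. w k \<in> F \<and> case_sum id id (w k) \<in> B k - {t}"
    by (elim exE)
  have "inj_on w {..<card I - 1}"
  proof (rule inj_onI)
    fix k l assume k: "k \<in> {..<card I - 1}" and l: "l \<in> {..<card I - 1}" and "w k = w l"
    define s where "s = case_sum id id (w k)"
    have s: "s \<in> B k" "s \<in> B l" "s \<noteq> t"
      using bspec[OF w k] bspec[OF w l] \<open>w k = w l\<close> by (simp_all add: s_def)
    \<comment> \<open>Where \<open>s\<close> differs from \<open>t\<close>, it takes the value of
      \<open>g k\<close>, which determines \<open>k\<close>.\<close>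
    have "\<exists>j\<in>I - {i}. s j \<noteq> t j"
    proof (rule ccontr)
      assume "\<not> ?thesis"
      then have "s = t"
        using s(1) tB[of k] unfolding B_def by (intro PiE_ext) auto
      then show False using s(3) by simp
    qed
    then obtain j where j: "j \<in> I - {i}" "s j \<noteq> t j" by blast
    then have "s j = g k j" "s j = g l j"
      using s unfolding B_def by (auto simp: PiE_def Pi_def)
    then show "k = l" using inj_onD[OF bspec[OF ginj j(1)] _ k l] by simp
  qed
  then have "card I - 1 \<le> card F"
    using card_inj_on_le[of w "{..<card I - 1}" F] w finF by (simp add: image_subset_iff)
  also have "card F = (deg i x - 1) + deg i y"
    unfolding F_def using tx finite_link by (subst card_Plus) auto
  finally have "card I - 1 \<le> deg i x - 1 + deg i y" .
  moreover have "deg i x > 0"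
    using tx finite_link[of i x] card_gt_0_iff[of "lk i x"] by blast
  ultimately show ?thesis by linarith
qed

text \<open>A transversal in just one of the two links would bring the degree sum up to
  \<open>card I\<close>, by \<open>deg_add_ge\<close> with \<open>x\<close> and \<open>y\<close> in
  either order.\<close>

lemma link_eq:
  assumes "i \<in> I" "x \<in> V i" "y \<in> V i" "deg i x + deg i y < card I"
  shows "lk i x = lk i y"
  using deg_add_ge[of i x y] deg_add_ge[of i y x] assms by (auto simp: add.commute)

section \<open>Low vertices and the number of edges\<close>

text \<open>The strict bound makes two low degrees add up to less than \<open>card I\<close>, as
  \<open>link_eq\<close> requires.\<close>

definition low :: "'i \<Rightarrow> 'a set" where
  "low i = {v \<in> V i. 2 * deg i v < card I}"

lemma link_low_eq: "i \<in> I \<Longrightarrow> x \<in> low i \<Longrightarrow> y \<in> low i \<Longrightarrow> lk i x = lk i y"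
  by (rule link_eq) (auto simp: low_def)

text \<open>With \<open>n = card I\<close>, \<open>a\<close> low vertices of common degree
  \<open>m \<le> n/2\<close> and the others of degree at least \<open>n - m\<close>, twice the
  degree sum is at least \<open>n^2 + (n - 2a)(n - 2m)\<close>. For \<open>a \<le> n/2\<close> both
  factors are nonnegative, contradicting \<open>few\<close>.\<close>

lemma card_low:
  assumes i: "i \<in> I" and few: "2 * card E < card I ^ 2"
  shows "card I < 2 * card (low i)"
proof (rule ccontr)
  assume a: "\<not> card I < 2 * card (low i)"
  have lowV: "low i \<subseteq> V i" by (auto simp: low_def)
  obtain m where m: "2 * m \<le> card I" "\<And>v. v \<in> low i \<Longrightarrow> m \<le> deg i v"
    "\<And>v. v \<in> V i - low i \<Longrightarrow> card I - m \<le> deg i v"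
  proof (cases "low i = {}")
    case True
    then have "card I \<le> 2 * deg i v" if "v \<in> V i" for v
      using that by (auto simp: low_def not_less)
    \<comment> \<open>Integrality rounds the bound \<open>card I / 2\<close> up, so
      \<open>m = card I div 2\<close> serves.\<close>
    then have "card I - card I div 2 \<le> deg i v" if "v \<in> V i" for v
      using that[THEN \<open>\<And>v. v \<in> V i \<Longrightarrow> card I \<le> 2 * deg i v\<close>] by linarith
    then show thesis
      using True by (intro that[of "card I div 2"]) auto
  next
    case False
    then obtain u where u: "u \<in> low i" by auto
    show thesis
    proof (rule that[of "deg i u"])
      show "2 * deg i u \<le> card I" using u by (simp add: low_def)
      show "deg i u \<le> deg i v" if "v \<in> low i" for v
        using link_low_eq[OF i u that] by simp
      \<comment> \<open>A vertex of smaller degree would share the link of \<open>u\<close> and so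
        be low.\<close>
      show "card I - deg i u \<le> deg i v" if v: "v \<in> V i - low i" for v
      proof (rule ccontr)
        assume "\<not> ?thesis"
        then have "deg i u + deg i v < card I" by linarith
        then have "lk i u = lk i v"
          using link_eq[OF i, of u v] u v lowV by blast
        then show False using u v by (auto simp: low_def)
      qed
    qed
  qed
  have "card (low i) * m + (card I - card (low i)) * (card I - m)
      = card (low i) * m + card (V i - low i) * (card I - m)"
    using card_Diff_subset[of "low i" "V i"] lowV finite_V[OF i] card_V[OF i] finite_subset by metis
  also have "\<dots> \<le> (\<Sum>v\<in>low i. deg i v) + (\<Sum>v\<in>V i - low i. deg i v)"
    using m sum_bounded_below[of "low i" m "deg i"]
      sum_bounded_below[of "V i - low i" "card I - m" "deg i"] by (intro add_mono) auto
  also have "\<dots> = card E"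
    using sum_deg[OF i] sum.subset_diff[OF lowV finite_V[OF i], of "deg i"] by simp
  finally have *: "card (low i) * m + (card I - card (low i)) * (card I - m) \<le> card E" .
  \<comment> \<open>Over the integers the differences are not truncated and the identity below is
    plain algebra.\<close>
  define n a where "n = int (card I)" and "a = int (card (low i))"
  have "int (card (low i) * m + (card I - card (low i)) * (card I - m)) \<le> int (card E)"
    using * by (simp only: of_nat_le_iff)
  then have "a * int m + (n - a) * (n - int m) \<le> int (card E)"
    using a m(1) unfolding n_def a_def by (simp add: of_nat_diff)
  moreover have "2 * (a * int m + (n - a) * (n - int m)) = n\<^sup>2 + (n - 2 * a) * (n - 2 * int m)"
    by (simp add: algebra_simps power2_eq_square)
  moreover have "(n - 2 * a) * (n - 2 * int m) \<ge> 0"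
    using a m(1) by (intro mult_nonneg_nonneg) (auto simp: n_def a_def)
  ultimately have "n\<^sup>2 \<le> 2 * int (card E)" by (smt (verit))
  then show False using few unfolding n_def
    by (metis linorder_not_less of_nat_le_iff of_nat_mult of_nat_numeral of_nat_power)
qed

text \<open>Low vertices of one colour have the same link and make up more than half of the colour,
  so an edge through two low vertices would give each of them too large a degree.\<close>

lemma no_edge_through_two_low:
  assumes few: "2 * card E < card I ^ 2"
    and e: "e \<in> E" and i: "i \<in> I" and j: "j \<in> I" and "i \<noteq> j" and ei: "e i \<in> low i" and ej: "e j \<in> low j"
  shows False
proof -
  have "e \<in> Pi\<^sub>E I V" using e E_sub by auto
  then have *: "e(j := undefined) \<in> lk j (e j)"
    using e by (auto simp: link_def PiE_def Pi_def extensional_def)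
  \<comment> \<open>Every low \<open>b\<close> can replace \<open>e j\<close>; the resulting edges
    all pass through \<open>e i\<close>, which gets degree above \<open>card I / 2\<close>.\<close>
  have "e(j := b) \<in> {f \<in> E. f i = e i}" if "b \<in> low j" for b
  proof -
    have "e(j := undefined) \<in> lk j b"
      using * link_low_eq[OF j ej that] by simp
    then have "e(j := b) \<in> E" by (simp add: link_def)
    then show ?thesis using \<open>i \<noteq> j\<close> by simp
  qed
  moreover have "inj_on (\<lambda>b. e(j := b)) (low j)"
    by (rule inj_onI) (metis fun_upd_same)
  ultimately have "card (low j) \<le> deg i (e i)"
    unfolding deg_eq[OF i] using finite_E by (intro card_inj_on_le) auto
  then show False
    using card_low[OF j few] ei by (simp add: low_def)
qed

theorem card_edges: "card I ^ 2 \<le> 2 * card E"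
proof (rule ccontr)
  assume "\<not> ?thesis"
  then have few: "2 * card E < card I ^ 2" by simp
  \<comment> \<open>Vertices are pairs of a colour and a point, since the sets \<open>V i\<close>
    may overlap in the locale.\<close>
  have "\<exists>e\<in>E. e (fst q) = snd q" if "q \<in> Sigma I low" for q
    using that no_isolated by (auto simp: low_def)
  then obtain h where h: "\<And>q. q \<in> Sigma I low \<Longrightarrow> h q \<in> E \<and> h q (fst q) = snd q"
    by metis
  \<comment> \<open>An edge chosen for vertices of two different colours would pass through two low
    vertices.\<close>
  have "inj_on h (Sigma I low)"
  proof (rule inj_onI)
    fix q r assume q: "q \<in> Sigma I low" and r: "r \<in> Sigma I low" and eq: "h q = h r"
    have "fst q = fst r"
    proof (rule ccontr)
      assume "fst q \<noteq> fst r"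
      moreover have "fst q \<in> I" "fst r \<in> I" "snd q \<in> low (fst q)" "snd r \<in> low (fst r)"
        using q r by auto
      ultimately show False
        using no_edge_through_two_low[OF few, of "h q" "fst q" "fst r"] h[OF q] h[OF r] eq by metis
    qed
    then show "q = r" using h[OF q] h[OF r] eq by (simp add: prod_eq_iff)
  qed
  then have "card (Sigma I low) \<le> card E"
    using finite_E h by (intro card_inj_on_le[of h]) auto
  moreover have "card (Sigma I low) = (\<Sum>i\<in>I. card (low i))"
    using finite_I finite_V by (intro card_SigmaI) (auto simp: low_def)
  moreover have "card I * card I \<le> (\<Sum>i\<in>I. 2 * card (low i))"
    using card_low[OF _ few] sum_bounded_below[of I "card I" "\<lambda>i. 2 * card (low i)"]
    by (simp add: less_imp_le)
  ultimately show False using few by (simp add: power2_eq_square flip: sum_distrib_left)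
qed

end

section \<open>Convex geometry\<close>

lemma general_position_subset:
  "general_position P \<Longrightarrow> Q \<subseteq> P \<Longrightarrow> general_position Q"
  unfolding general_position_def by blast

text \<open>The convex representations of \<open>p\<close> by \<open>d + 2\<close> points in general position form a segment or
  the empty set, and the ends of the segment are the representations omitting one point.\<close>

lemma even_card_facets_containing:
  fixes T :: "(real^'n) set"
  assumes fin: "finite T" and card_T: "card T = CARD('n) + 2" and pT: "p \<notin> T"
    and gp: "general_position (insert p T)"
  shows "even (card {v \<in> T. p \<in> convex hull (T - {v})})"
proof (cases "{v \<in> T. p \<in> convex hull (T - {v})} = {}")
  case True
  show ?thesis unfolding True by simp
next
  case False
  define F where "F = {v \<in> T. p \<in> convex hull (T - {v})}"
  define bary where "bary c \<longleftrightarrow> (\<forall>x\<in>T. 0 \<le> c x) \<and> sum c T = 1 \<and> (\<Sum>x\<in>T. c x *\<^sub>R x) = p"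
    for c :: "real^'n \<Rightarrow> real"
  have F_iff: "v \<in> F \<longleftrightarrow> v \<in> T \<and> (\<exists>c. bary c \<and> c v = 0)" for v
  proof
    assume v: "v \<in> F"
    then obtain c where c: "\<forall>x\<in>T - {v}. 0 \<le> c x" "sum c (T - {v}) = 1" "(\<Sum>x\<in>T - {v}. c x *\<^sub>R x) = p"
      unfolding F_def using fin by (auto simp: convex_hull_finite)
    have "v \<in> T" using v by (simp add: F_def)
    then have "bary (c(v := 0))"
      using c fin unfolding bary_def by (auto simp: sum.remove[of T v])
    then show "v \<in> T \<and> (\<exists>c. bary c \<and> c v = 0)"
      using \<open>v \<in> T\<close> by (metis fun_upd_same)
  next
    assume "v \<in> T \<and> (\<exists>c. bary c \<and> c v = 0)"
    then obtain c where c: "v \<in> T" "bary c" "c v = 0" by auto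
    then have "p \<in> convex hull (T - {v})"
      using fin unfolding bary_def by (auto simp: convex_hull_finite sum.remove[of T v])
    then show "v \<in> F" using c by (simp add: F_def)
  qed
  \<comment> \<open>Two zero coefficients would leave \<open>p\<close> in the hull of d points, an
    affine dependence among d + 1 points of \<open>insert p T\<close>.\<close>
  have zero_unique: "u = w" if c: "bary c" "c u = 0" "c w = 0" and uw: "u \<in> T" "w \<in> T" for c u w
  proof (rule ccontr)
    assume "u \<noteq> w"
    have "sum c (T - {u, w}) = sum c T" "(\<Sum>x\<in>T - {u, w}. c x *\<^sub>R x) = (\<Sum>x\<in>T. c x *\<^sub>R x)"
      using c fin by (intro sum.mono_neutral_left; auto)+
    then have "p \<in> convex hull (T - {u, w})"
      using c fin unfolding bary_def by (auto simp: convex_hull_finite)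
    then have "p \<in> affine hull (insert p (T - {u, w}) - {p})"
      using convex_hull_subset_affine_hull pT by fastforce
    then have "affine_dependent (insert p (T - {u, w}))"
      unfolding affine_dependent_def by blast
    moreover have "card (insert p (T - {u, w})) = CARD('n) + 1"
      using card_T fin pT uw \<open>u \<noteq> w\<close> by (simp add: card_Diff_subset)
    ultimately show False
      using gp unfolding general_position_def by (metis Diff_subset insert_mono order_refl)
  qed
  obtain v where v: "v \<in> F" using False by (auto simp: F_def)
  then obtain l where vT: "v \<in> T" and l: "bary l" "l v = 0" using F_iff by blast
  have "\<not> affine_dependent (T - {v})"
  proof -
    have "card (T - {v}) \<le> CARD('n) + 1" "T - {v} \<subseteq> insert p T"
      using card_T fin vT by (auto simp: card_Diff_subset)
    then show ?thesis using gp unfolding general_position_def by blast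
  qed
  \<comment> \<open>Affine relations on \<open>T\<close> are determined by their value at
    \<open>v\<close>, so they form at most a line; \<open>m\<close> below is its generator with
    value 1 at \<open>v\<close>.\<close>
  then have indep: "\<forall>x\<in>T. U x = 0"
    if U: "U v = 0" "sum U T = 0" "(\<Sum>x\<in>T. U x *\<^sub>R x) = 0" for U
    using that fin vT by (auto simp: affine_dependent_explicit_finite sum.remove[of T v])
  have "affine_dependent T"
    using fin card_T by (intro affine_dependent_biggerset) auto
  then obtain U where U: "sum U T = 0" "\<exists>x\<in>T. U x \<noteq> 0" "(\<Sum>x\<in>T. U x *\<^sub>R x) = 0"
    using fin by (auto simp: affine_dependent_explicit_finite)
  then have Uv: "U v \<noteq> 0" using indep by blast
  define m where "m x = U x / U v" for x
  have m: "m v = 1" "sum m T = 0" "(\<Sum>x\<in>T. m x *\<^sub>R x) = 0"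
  proof -
    show "m v = 1" using Uv by (simp add: m_def)
    show "sum m T = 0" using U by (simp add: m_def flip: sum_divide_distrib)
    have "(\<Sum>x\<in>T. m x *\<^sub>R x) = (1 / U v) *\<^sub>R (\<Sum>x\<in>T. U x *\<^sub>R x)"
      unfolding scaleR_sum_right by (simp add: m_def)
    then show "(\<Sum>x\<in>T. m x *\<^sub>R x) = 0" using U by simp
  qed
  define N where "N = {u \<in> T. m u < 0}"
  have "N \<noteq> {}"
  proof
    assume "N = {}"
    then have "\<forall>u\<in>T. 0 \<le> m u" by (auto simp: N_def not_less)
    then have "m v = 0" using m(2) sum_nonneg_eq_0_iff[OF fin, of m] vT by simp
    then show False using m(1) by simp
  qed
  moreover have finN: "finite N" using fin by (simp add: N_def)
  \<comment> \<open>Ratio test: moving from \<open>l\<close> along \<open>m\<close>, the coefficient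
    of \<open>v'\<close> is the first to reach 0, after a step of length \<open>s\<close>.\<close>
  ultimately obtain v' where v': "v' \<in> N" and
    v'_min: "\<And>u. u \<in> N \<Longrightarrow> l v' / (- m v') \<le> l u / (- m u)"
    using arg_min_if_finite(1)[of N "\<lambda>u. l u / (- m u)"]
      arg_min_least[of N _ "\<lambda>u. l u / (- m u)"] by blast
  define s where "s = l v' / (- m v')"
  have mv': "v' \<in> T" "m v' < 0" using v' by (auto simp: N_def)
  have l0: "0 \<le> l u" if "u \<in> T" for u using l that by (simp add: bary_def)
  have s0: "0 \<le> s" using l0[OF mv'(1)] mv' unfolding s_def by (intro divide_nonneg_pos) auto
  define c where "c u = l u + s * m u" for u
  have c: "bary c" "c v' = 0"
  proof -
    have "0 \<le> c u" if u: "u \<in> T" for u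
    proof (cases "m u < 0")
      case True
      then have "s \<le> l u / (- m u)" using v'_min u by (auto simp: N_def s_def)
      then show ?thesis using True by (simp add: c_def field_simps)
    next
      case False
      then show ?thesis using l0[OF u] s0 by (simp add: c_def)
    qed
    moreover have "(\<Sum>x\<in>T. (s * m x) *\<^sub>R x) = s *\<^sub>R (\<Sum>x\<in>T. m x *\<^sub>R x)"
      by (simp add: scaleR_sum_right)
    ultimately show "bary c" using l m
      by (simp add: bary_def c_def sum.distrib scaleR_add_left flip: sum_distrib_left)
    show "c v' = 0" using mv' by (simp add: c_def s_def)
  qed
  \<comment> \<open>A representation \<open>k\<close> vanishing at \<open>w\<close> has the form
    \<open>l + r m\<close>. Nonnegativity at \<open>v'\<close> gives \<open>r \<le> s\<close> and
    the choice of \<open>v'\<close> gives \<open>s \<le> r\<close>, so \<open>k\<close> agrees with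
    \<open>c\<close> and \<open>zero_unique\<close> applies.\<close>
  have F_only: "w = v'" if w: "w \<in> F" "w \<noteq> v" for w
  proof -
    obtain k where k: "w \<in> T" "bary k" "k w = 0" using w F_iff by blast
    define r where "r = k v"
    have r0: "0 \<le> r" using k vT by (simp add: r_def bary_def)
    have "(\<Sum>x\<in>T. (r * m x) *\<^sub>R x) = r *\<^sub>R (\<Sum>x\<in>T. m x *\<^sub>R x)"
      by (simp add: scaleR_sum_right)
    then have "\<forall>x\<in>T. k x - l x - r * m x = 0"
      using k l m by (intro indep)
        (simp_all add: r_def bary_def sum_subtractf scaleR_diff_left flip: sum_distrib_left)
    then have k_eq: "k x = l x + r * m x" if "x \<in> T" for x using that by force
    have "l w \<noteq> 0" using zero_unique[OF l(1) _ l(2) k(1) vT] w by blast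
    then have lw: "0 < l w" using l0[OF k(1)] by simp
    have kw: "l w + r * m w = 0" using k_eq k by simp
    then have mw: "m w < 0" using lw r0 by (metis add_pos_nonneg less_irrefl mult_nonneg_nonneg not_less)
    have "0 \<le> k v'" using k mv' by (simp add: bary_def)
    then have "0 \<le> l v' + r * m v'" using k_eq[OF mv'(1)] by simp
    then have "r \<le> s" using mv' by (simp add: s_def field_simps)
    moreover have "s \<le> r"
    proof -
      have "s \<le> l w / (- m w)" using v'_min mw k by (auto simp: N_def s_def)
      also have "\<dots> = r" using kw mw by (simp add: field_simps)
      finally show ?thesis .
    qed
    ultimately have "c w = 0" using kw by (simp add: c_def)
    then show ?thesis using zero_unique[OF c(1) _ c(2) k(1) mv'(1)] by blast
  qed
  have "v' \<in> F" using F_iff c mv' by blast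
  then have "F = {v, v'}" using v F_only by blast
  moreover have "v \<noteq> v'" using m(1) mv'(2) by auto
  ultimately have "card F = 2" by simp
  then show ?thesis unfolding F_def by simp
qed

section \<open>Colourful Caratheodory theorem\<close>

lemma sum_in_convex_cone_hull:
  assumes "\<And>u. u \<in> A \<Longrightarrow> f u \<in> convex_cone hull S"
  shows "sum f A \<in> convex_cone hull S"
  using assms
  by (induction A rule: infinite_finite_induct)
    (auto intro: convex_cone_hull_add convex_cone_hull_contains_0)

text \<open>Barany's argument in its conic form: choose the transversal whose cone at \<open>p\<close> is closest
  to the direction \<open>p - x\<close>; if it misses, the nearest point lies in a proper face and the
  unused vertex can be exchanged for one on the other side of the supporting hyperplane.\<close>

lemma colourful_caratheodory:
  fixes S :: "'i \<Rightarrow> 'a::euclidean_space set" and p x :: 'a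
  assumes finJ: "finite J" and J: "J \<noteq> {}"
    and finS: "\<And>j. j \<in> J \<Longrightarrow> finite (S j)"
    and p_int: "\<And>j. j \<in> J \<Longrightarrow> p \<in> interior (convex hull (S j))"
    and spans: "\<And>t. t \<in> Pi\<^sub>E J S \<Longrightarrow> span ((\<lambda>j. t j - p) ` J) = UNIV"
  shows "\<exists>t\<in>Pi\<^sub>E J S. p \<in> convex hull (insert x (t ` J))"
proof -
  define K where "K t = convex_cone hull ((\<lambda>j. t j - p) ` J)" for t
  \<comment> \<open>\<open>p\<close> lies in the simplex on \<open>x\<close> and the points
    \<open>t j\<close> as soon as the direction \<open>a\<close> lies in the cone
    \<open>K t\<close>.\<close>
  define a where "a = p - x"
  have "finite (Pi\<^sub>E J S)" using finJ finS by (intro finite_PiE) auto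
  moreover have "Pi\<^sub>E J S \<noteq> {}"
  proof -
    have "S j \<noteq> {}" if "j \<in> J" for j
      using p_int[OF that] by auto
    then show ?thesis by (simp add: PiE_eq_empty_iff)
  qed
  ultimately obtain t where t: "t \<in> Pi\<^sub>E J S"
    and t_min: "\<And>t'. t' \<in> Pi\<^sub>E J S \<Longrightarrow> infdist a (K t) \<le> infdist a (K t')"
    using arg_min_if_finite(1)[of "Pi\<^sub>E J S" "\<lambda>t. infdist a (K t)"]
      arg_min_least[of "Pi\<^sub>E J S" _ "\<lambda>t. infdist a (K t)"] by blast
  have K_closed: "closed (K t)" and K_convex: "convex (K t)" and K_ne: "K t \<noteq> {}" for t
    using finJ by (auto simp: K_def closed_convex_cone_hull convex_convex_cone_hull convex_cone_hull_nonempty)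
  obtain z where z: "z \<in> K t" "infdist a (K t) = dist a z"
    using infdist_attains_inf[OF K_closed K_ne] by metis
  define U where "U = (\<lambda>j. t j - p) ` J"
  have U: "finite U" "U \<noteq> {}" using finJ J by (auto simp: U_def)
  obtain c w where c: "0 \<le> c" and w: "w \<in> convex hull U" and zc: "z = c *\<^sub>R w"
    using z(1) U unfolding K_def by (auto simp: U_def convex_cone_hull_convex_hull_nonempty)
  have "z = a"
  proof (rule ccontr)
    assume "z \<noteq> a"
    \<comment> \<open>As \<open>t\<close> minimises the distance over all transversals,
      \<open>z\<close> is nearest to \<open>a\<close> in every cone \<open>K t'\<close> that
      contains it, not only in \<open>K t\<close>.\<close>
    have dot: "(a - z) \<bullet> (y - z) \<le> 0" if t': "t' \<in> Pi\<^sub>E J S" and "z \<in> K t'" "y \<in> K t'" for t' y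
    proof (rule any_closest_point_dot[OF K_convex K_closed that(2,3)])
      show "\<forall>y\<in>K t'. dist a z \<le> dist a y"
      proof
        fix y assume "y \<in> K t'"
        then have "infdist a (K t') \<le> dist a y" by (rule infdist_le)
        then show "dist a z \<le> dist a y" using t_min[OF t'] z(2) by linarith
      qed
    qed
    have dotU: "(a - z) \<bullet> u \<le> 0" if "u \<in> U" for u
    proof -
      have "u \<in> K t" using that by (simp add: K_def U_def hull_inc)
      then have "z + u \<in> K t" using z by (simp add: K_def convex_cone_hull_add)
      then show ?thesis using dot[OF t z(1)] by fastforce
    qed
    have "0 \<in> K t" by (simp add: K_def convex_cone_hull_contains_0)
    then have "(a - z) \<bullet> z \<ge> 0" using dot[OF t z(1)] by fastforce
    obtain b where b: "\<forall>u\<in>U. 0 \<le> b u" "(\<Sum>u\<in>U. b u *\<^sub>R u) = w"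
      using w U by (auto simp: convex_hull_finite)
    have z_sum: "z = (\<Sum>u\<in>U. (c * b u) *\<^sub>R u)"
      unfolding zc b(2)[symmetric] by (simp add: scaleR_sum_right)
    \<comment> \<open>\<open>(a - z) \<bullet> z\<close> is nonnegative, yet all its terms are
      nonpositive; so they vanish, and \<open>z\<close> uses only generators orthogonal to
      \<open>a - z\<close>.\<close>
    have nonneg: "0 \<le> - (c * b u * ((a - z) \<bullet> u))" if "u \<in> U" for u
      using dotU[OF that] b c that by (simp add: mult_nonneg_nonpos)
    have "(\<Sum>u\<in>U. - (c * b u * ((a - z) \<bullet> u))) = - ((a - z) \<bullet> z)"
      by (subst (2) z_sum) (simp add: inner_sum_right sum_negf)
    moreover have "(\<Sum>u\<in>U. - (c * b u * ((a - z) \<bullet> u))) \<ge> 0"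
      using nonneg by (intro sum_nonneg) auto
    ultimately have "(\<Sum>u\<in>U. - (c * b u * ((a - z) \<bullet> u))) = 0"
      using \<open>(a - z) \<bullet> z \<ge> 0\<close> by linarith
    then have all0: "c * b u * ((a - z) \<bullet> u) = 0" if "u \<in> U" for u
      using sum_nonneg_eq_0_iff[OF U(1), of "\<lambda>u. - (c * b u * ((a - z) \<bullet> u))"] nonneg that by auto
    \<comment> \<open>A spanning set is not orthogonal to a nonzero vector; the generator found here
      has coefficient 0 in \<open>z\<close>.\<close>
    have "\<exists>u\<in>U. (a - z) \<bullet> u \<noteq> 0"
    proof (rule ccontr)
      assume "\<not> ?thesis"
      moreover have "a - z \<in> span U" using spans[OF t] by (simp add: U_def)
      ultimately have "orthogonal (a - z) (a - z)"
        by (intro orthogonal_to_span[of "a - z" U]) (auto simp: orthogonal_def)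
      then show False using \<open>z \<noteq> a\<close> by (simp add: orthogonal_def)
    qed
    then obtain j where j: "j \<in> J" "(a - z) \<bullet> (t j - p) \<noteq> 0" by (auto simp: U_def)
    \<comment> \<open>Otherwise \<open>S j\<close> would lie in a closed half-space with
      \<open>p\<close> on its boundary, and \<open>p\<close> would not be interior.\<close>
    have "\<exists>y\<in>S j. (a - z) \<bullet> (y - p) > 0"
    proof (rule ccontr)
      assume "\<not> ?thesis"
      then have "S j \<subseteq> {y. (a - z) \<bullet> y \<le> (a - z) \<bullet> p}"
        by (auto simp: inner_diff_right not_less)
      then have "convex hull (S j) \<subseteq> {y. (a - z) \<bullet> y \<le> (a - z) \<bullet> p}"
        by (simp add: hull_minimal convex_halfspace_le)
      then have "p \<in> interior {y. (a - z) \<bullet> y \<le> (a - z) \<bullet> p}"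
        using p_int[OF j(1)] interior_mono by blast
      then show False using \<open>z \<noteq> a\<close> by simp
    qed
    then obtain y where y: "y \<in> S j" "(a - z) \<bullet> (y - p) > 0" by blast
    define t' where "t' = t(j := y)"
    have t': "t' \<in> Pi\<^sub>E J S" using t y j by (auto simp: t'_def PiE_def Pi_def extensional_def)
    \<comment> \<open>The exchange removes at most the generator \<open>t j - p\<close>, which
      \<open>z\<close> does not use.\<close>
    have "(c * b u) *\<^sub>R u \<in> K t'" if u: "u \<in> U" for u
    proof (cases "u = t j - p")
      case True
      then have "c * b u = 0" using all0[OF u] j by simp
      then show ?thesis by (simp only: K_def scaleR_zero_left convex_cone_hull_contains_0)
    next
      case False
      then obtain k where k: "k \<in> J" "k \<noteq> j" "u = t k - p" using u by (auto simp: U_def)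
      then have "u = t' k - p" by (simp add: t'_def)
      then have "u \<in> K t'" using k by (simp add: K_def hull_inc)
      then show ?thesis using b c u by (simp add: K_def convex_cone_hull_mul)
    qed
    then have zK: "z \<in> K t'" unfolding K_def
      by (subst z_sum) (rule sum_in_convex_cone_hull)
    have "y - p = t' j - p" by (simp add: t'_def)
    then have "y - p \<in> K t'" unfolding K_def using j by (intro hull_inc) blast
    then have "z + (y - p) \<in> K t'" using zK by (simp add: K_def convex_cone_hull_add)
    then show False using dot[OF t' zK] y by fastforce
  qed
  have "(\<lambda>u. p + u) ` U = t ` J" by (force simp: U_def)
  then have "p + w \<in> convex hull (t ` J)"
    using w convex_hull_translation[of p U] by auto
  then have pw: "p + w \<in> convex hull (insert x (t ` J))"
    using hull_mono[of "t ` J" "insert x (t ` J)"] by blast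
  \<comment> \<open>Adding \<open>c p\<close> to both sides of \<open>p = x + c w\<close> and
    dividing by \<open>1 + c\<close> writes \<open>p\<close> as a convex combination of
    \<open>x\<close> and \<open>p + w\<close>.\<close>
  have "(1 / (1 + c)) *\<^sub>R x + (c / (1 + c)) *\<^sub>R (p + w) \<in> convex hull (insert x (t ` J))"
    using c by (intro convexD[OF convex_convex_hull _ pw] hull_inc)
      (auto simp flip: add_divide_distrib)
  also have "(1 / (1 + c)) *\<^sub>R x + (c / (1 + c)) *\<^sub>R (p + w) = (1 / (1 + c)) *\<^sub>R (x + c *\<^sub>R w + c *\<^sub>R p)"
    by (simp add: scaleR_add_right add.commute)
  also have "x + c *\<^sub>R w + c *\<^sub>R p = (1 + c) *\<^sub>R p"
    using zc \<open>z = a\<close> by (simp add: a_def algebra_simps)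
  also have "(1 / (1 + c)) *\<^sub>R (1 + c) *\<^sub>R p = p"
    using c by simp
  finally show ?thesis using t by blast
qed

section \<open>Transversals and parity over octahedra\<close>

lemma inj_on_transversal:
  assumes "s \<in> Pi\<^sub>E J S" and "\<And>i j. i \<in> J \<Longrightarrow> j \<in> J \<Longrightarrow> i \<noteq> j \<Longrightarrow> S i \<inter> S j = {}"
  shows "inj_on s J"
proof (rule inj_onI)
  fix i j assume ij: "i \<in> J" "j \<in> J" "s i = s j"
  then have "s i \<in> S i \<inter> S j" using assms(1) PiE_mem by fastforce
  then show "i = j" using assms(2) ij by blast
qed

text \<open>General position makes \<open>p\<close> and the d points affinely independent, so the d
  differences form a basis.\<close>

lemma span_transversal:
  fixes s :: "'i \<Rightarrow> real^'n"
  assumes "finite J" and card_J: "card J = CARD('n)" and inj: "inj_on s J"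
    and p: "p \<notin> s ` J" and gp: "general_position (insert p (s ` J))"
  shows "span ((\<lambda>j. s j - p) ` J) = UNIV"
proof -
  have "card (s ` J) = CARD('n)" using card_image[OF inj] card_J by simp
  then have "card (insert p (s ` J)) \<le> CARD('n) + 1" using p \<open>finite J\<close> by simp
  then have "\<not> affine_dependent (insert p (s ` J))"
    using gp unfolding general_position_def by blast
  then have "independent ((\<lambda>x. - p + x) ` (s ` J))"
    by (simp add: affine_dependent_iff_dependent[OF p])
  also have "(\<lambda>x. - p + x) ` (s ` J) = (\<lambda>j. s j - p) ` J" by (auto simp: image_image)
  finally have ind: "independent ((\<lambda>j. s j - p) ` J)" .
  have "inj_on (\<lambda>j. s j - p) J" using inj by (auto simp: inj_on_def)
  then have "card ((\<lambda>j. s j - p) ` J) = DIM(real^'n)" using card_J by (simp add: card_image)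
  then have "dim ((\<lambda>j. s j - p) ` J) = DIM(real^'n)"
    using ind by (simp add: dim_eq_card_independent)
  then show ?thesis using dim_eq_full by blast
qed

text \<open>Switching colour \<open>j\<close> between \<open>t j\<close> and \<open>t' j\<close>
  pairs up the \<open>s\<close> that satisfy \<open>Q\<close>. \<open>octahedron_parity\<close>
  applies this to facets without colour \<open>j\<close>.\<close>

lemma even_card_flip_invariant:
  assumes j: "j \<in> J" and "t j \<noteq> t' j" and fin: "finite J"
    and Q: "\<And>s v. s \<in> Pi\<^sub>E J (\<lambda>j. {t j, t' j}) \<Longrightarrow> v \<in> {t j, t' j} \<Longrightarrow> Q s \<Longrightarrow> Q (s(j := v))"
  shows "even (card {s \<in> Pi\<^sub>E J (\<lambda>j. {t j, t' j}). Q s})"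
proof -
  define B where "B = Pi\<^sub>E J (\<lambda>j. {t j, t' j})"
  have finB: "finite B" using fin unfolding B_def by (intro finite_PiE) auto
  have updB: "s(j := v) \<in> B" if "s \<in> B" "v \<in> {t j, t' j}" for s v
    using that j by (auto simp: B_def PiE_def Pi_def extensional_def)
  have Q': "Q (s(j := v))" if "s \<in> B" "v \<in> {t j, t' j}" "Q s" for s v
    using Q that unfolding B_def by blast
  have "bij_betw (\<lambda>s. s(j := t' j)) {s \<in> B. Q s \<and> s j = t j} {s \<in> B. Q s \<and> s j = t' j}"
  proof (rule bij_betw_byWitness[where f' = "\<lambda>s. s(j := t j)"])
    show "(\<lambda>s. s(j := t' j)) ` {s \<in> B. Q s \<and> s j = t j} \<subseteq> {s \<in> B. Q s \<and> s j = t' j}"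
      using updB Q' by fastforce
    show "(\<lambda>s. s(j := t j)) ` {s \<in> B. Q s \<and> s j = t' j} \<subseteq> {s \<in> B. Q s \<and> s j = t j}"
      using updB Q' by fastforce
  qed (auto simp: fun_upd_idem)
  then have eq: "card {s \<in> B. Q s \<and> s j = t j} = card {s \<in> B. Q s \<and> s j = t' j}"
    by (rule bij_betw_same_card)
  have "s j = t j \<or> s j = t' j" if "s \<in> B" for s
    using that j by (auto simp: B_def)
  then have "{s \<in> B. Q s} = {s \<in> B. Q s \<and> s j = t j} \<union> {s \<in> B. Q s \<and> s j = t' j}" by blast
  moreover have "card ({s \<in> B. Q s \<and> s j = t j} \<union> {s \<in> B. Q s \<and> s j = t' j})
      = card {s \<in> B. Q s \<and> s j = t j} + card {s \<in> B. Q s \<and> s j = t' j}"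
    using finB \<open>t j \<noteq> t' j\<close> by (intro card_Un_disjoint) auto
  ultimately have "card {s \<in> B. Q s} = 2 * card {s \<in> B. Q s \<and> s j = t j}"
    using eq by simp
  then show ?thesis unfolding B_def by simp
qed

text \<open>Sum the parity of \<open>even_card_facets_containing\<close> over the sets \<open>s ` J \<union> {x, y}\<close>: a facet
  that contains both \<open>x\<close> and \<open>y\<close> misses one colour and so is counted exactly twice.\<close>

lemma octahedron_parity:
  fixes S :: "'i \<Rightarrow> (real^'n) set"
  assumes finJ: "finite J" and card_J: "card J = CARD('n)"
    and disj: "\<And>i j. i \<in> J \<Longrightarrow> j \<in> J \<Longrightarrow> i \<noteq> j \<Longrightarrow> S i \<inter> S j = {}"
    and xy: "x \<noteq> y" and x: "x \<notin> (\<Union>j\<in>J. S j)" and y: "y \<notin> (\<Union>j\<in>J. S j)"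
    and p: "p \<notin> {x, y} \<union> (\<Union>j\<in>J. S j)"
    and gp: "general_position (insert p ({x, y} \<union> (\<Union>j\<in>J. S j)))"
    and t: "t \<in> Pi\<^sub>E J S" and t': "t' \<in> Pi\<^sub>E J S" and tt': "\<And>j. j \<in> J \<Longrightarrow> t j \<noteq> t' j"
  defines "B \<equiv> Pi\<^sub>E J (\<lambda>j. {t j, t' j})"
  shows "even (card {s \<in> B. p \<in> convex hull (insert x (s ` J))}
    + card {s \<in> B. p \<in> convex hull (insert y (s ` J))})"
proof -
  define R where "R s j \<longleftrightarrow> p \<in> convex hull ({x, y} \<union> s ` (J - {j}))" for s j
  define X where "X s \<longleftrightarrow> p \<in> convex hull (insert x (s ` J))" for s
  define Y where "Y s \<longleftrightarrow> p \<in> convex hull (insert y (s ` J))" for s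
  have finB: "finite B" using finJ unfolding B_def by (intro finite_PiE) auto
  have BS: "s \<in> Pi\<^sub>E J S" if "s \<in> B" for s
  proof -
    have "B \<subseteq> Pi\<^sub>E J S" unfolding B_def using t t' by (intro PiE_mono) auto
    then show ?thesis using that by blast
  qed
  have even_s: "even (of_bool (X s) + of_bool (Y s) + card {j \<in> J. R s j})" if s: "s \<in> B" for s
  proof -
    define T where "T = {x, y} \<union> s ` J"
    have inj: "inj_on s J" using inj_on_transversal[OF BS[OF s] disj] .
    have sS: "s ` J \<subseteq> (\<Union>j\<in>J. S j)" using BS[OF s] by auto
    then have xs: "x \<notin> s ` J" and ys: "y \<notin> s ` J" using x y by auto
    have finT: "finite T" using finJ by (simp add: T_def)
    have "card T = CARD('n) + 2"
      using xy xs ys finJ card_image[OF inj] card_J by (simp add: T_def)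
    moreover have "p \<notin> T" using p sS by (auto simp: T_def)
    moreover have "general_position (insert p T)"
      using gp by (rule general_position_subset) (use sS in \<open>auto simp: T_def\<close>)
    ultimately have even_F: "even (card {v \<in> T. p \<in> convex hull (T - {v})})"
      by (rule even_card_facets_containing[OF finT])
    \<comment> \<open>Deleting \<open>y\<close> leaves the simplex at \<open>x\<close> and
      conversely, hence the swap of \<open>X\<close> and \<open>Y\<close> in the facts on
      \<open>P\<close>.\<close>
    have Ty: "T - {y} = insert x (s ` J)" and Tx: "T - {x} = insert y (s ` J)"
      using xy xs ys by (auto simp: T_def)
    have Tj: "T - {s j} = {x, y} \<union> s ` (J - {j})" if "j \<in> J" for j
      using that xs ys inj by (auto simp: T_def inj_on_def)
    define P where "P v \<longleftrightarrow> p \<in> convex hull (T - {v})" for v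
    have P: "P x \<longleftrightarrow> Y s" "P y \<longleftrightarrow> X s" "\<And>j. j \<in> J \<Longrightarrow> P (s j) \<longleftrightarrow> R s j"
      unfolding P_def X_def Y_def R_def by (simp_all only: Ty Tx Tj)
    have "{v \<in> T. P v} = {v \<in> {x}. Y s} \<union> {v \<in> {y}. X s} \<union> s ` {j \<in> J. R s j}"
      unfolding T_def using P by blast
    also have "card \<dots> = card {v \<in> {x}. Y s} + card {v \<in> {y}. X s} + card (s ` {j \<in> J. R s j})"
      using xy xs ys finJ by (subst card_Un_disjoint; (subst card_Un_disjoint)?; auto)
    also have "card (s ` {j \<in> J. R s j}) = card {j \<in> J. R s j}"
      using inj by (intro card_image) (auto simp: inj_on_def)
    finally show ?thesis using even_F unfolding P_def by (cases "X s"; cases "Y s") auto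
  qed
  have even_j: "even (card {s \<in> B. R s j})" if j: "j \<in> J" for j
    unfolding B_def
  proof (rule even_card_flip_invariant[of j J t t' "\<lambda>s. R s j", OF j tt'[OF j] finJ])
    fix s v assume "R s j"
    moreover have "(s(j := v)) ` (J - {j}) = s ` (J - {j})" by auto
    ultimately show "R (s(j := v)) j" by (simp add: R_def)
  qed
  have "(\<Sum>s\<in>B. of_bool (X s) + of_bool (Y s) + card {j \<in> J. R s j})
      = card {s \<in> B. X s} + card {s \<in> B. Y s} + (\<Sum>s\<in>B. card {j \<in> J. R s j})"
    using finB by (simp add: sum.distrib sum_of_bool_eq Int_def)
  also have "(\<Sum>s\<in>B. card {j \<in> J. R s j}) = (\<Sum>j\<in>J. card {s \<in> B. R s j})"
    by (rule sum_multicount_gen[OF finB finJ]) simp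
  finally have "(\<Sum>s\<in>B. of_bool (X s) + of_bool (Y s) + card {j \<in> J. R s j})
      = card {s \<in> B. X s} + card {s \<in> B. Y s} + (\<Sum>j\<in>J. card {s \<in> B. R s j})" .
  moreover have "even (\<Sum>s\<in>B. of_bool (X s) + of_bool (Y s) + card {j \<in> J. R s j})"
    using even_s by (intro dvd_sum) auto
  moreover have "even (\<Sum>j\<in>J. card {s \<in> B. R s j})"
    using even_j by (intro dvd_sum) auto
  ultimately show ?thesis unfolding X_def Y_def by simp
qed

section \<open>Colourful simplices as an octahedral system\<close>

theorem theorem1:
  fixes S :: "nat \<Rightarrow> (real^'n) set" and p :: "real^'n"
  assumes card_S: "\<And>i. i \<le> CARD('n) \<Longrightarrow> finite (S i) \<and> card (S i) = CARD('n) + 1"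
    and disj: "\<And>i j. i \<le> CARD('n) \<Longrightarrow> j \<le> CARD('n) \<Longrightarrow> i \<noteq> j \<Longrightarrow> S i \<inter> S j = {}"
    and p_notin: "p \<notin> (\<Union>i\<le>CARD('n). S i)"
    and gp: "general_position ((\<Union>i\<le>CARD('n). S i) \<union> {p})"
    and p_int: "\<And>i. i \<le> CARD('n) \<Longrightarrow> p \<in> interior (convex hull (S i))"
  shows "real_of_int \<lceil>real ((CARD('n) + 1)^2) / 2\<rceil>
           \<le> real (card (colourful_simplices_containing S p))"
proof -
  define I where "I = {..CARD('n)}"
  define E where "E = colourful_simplices_containing S p"
  have E_eq: "E = {x \<in> Pi\<^sub>E I S. p \<in> convex hull (x ` I)}"
    by (simp add: E_def colourful_simplices_containing_def I_def)
  have card_I: "card I = CARD('n) + 1" and finI: "finite I" by (simp_all add: I_def)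
  have disjI: "S i \<inter> S j = {}" if "i \<in> I" "j \<in> I" "i \<noteq> j" for i j
    using disj that by (simp add: I_def)
  have pI: "p \<notin> (\<Union>i\<in>I. S i)" and gpI: "general_position (insert p (\<Union>i\<in>I. S i))"
    using p_notin gp by (simp_all add: I_def)
  \<comment> \<open>Membership in \<open>E\<close> in the form shared by the Caratheodory and parity
    lemmas.\<close>
  have upd: "s(i := v) \<in> E \<longleftrightarrow> p \<in> convex hull (insert v (s ` (I - {i})))"
    if i: "i \<in> I" and v: "v \<in> S i" and s: "s \<in> Pi\<^sub>E (I - {i}) S" for s i v
  proof -
    have "s(i := v) \<in> Pi\<^sub>E I S"
      using i v s by (auto simp: PiE_def Pi_def extensional_def)
    moreover have "(s(i := v)) ` I = insert v (s ` (I - {i}))" using i by auto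
    ultimately show ?thesis by (simp add: E_eq)
  qed
  have fin_minus: "finite (I - {i})" and card_minus: "i \<in> I \<Longrightarrow> card (I - {i}) = CARD('n)" for i
    using finI card_I by auto
  have "octahedral_system I S E"
  proof
    show "finite I" by (rule finI)
    show "finite (S i)" "card (S i) = card I" if "i \<in> I" for i
      using card_S that by (auto simp: I_def)
    show "E \<subseteq> Pi\<^sub>E I S" by (auto simp: E_eq)
  next
    fix i v assume i: "i \<in> I" and v: "v \<in> S i"
    have "\<exists>t\<in>Pi\<^sub>E (I - {i}) S. p \<in> convex hull (insert v (t ` (I - {i})))"
    proof (rule colourful_caratheodory[OF fin_minus])
      show "I - {i} \<noteq> {}" using card_minus[OF i] by (metis card.empty zero_less_card_finite less_irrefl)
      show "finite (S j)" "p \<in> interior (convex hull (S j))" if "j \<in> I - {i}" for j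
        using card_S p_int that by (auto simp: I_def)
      show "span ((\<lambda>j. t j - p) ` (I - {i})) = UNIV" if t: "t \<in> Pi\<^sub>E (I - {i}) S" for t
      proof (rule span_transversal[OF fin_minus card_minus[OF i]])
        have sub: "t ` (I - {i}) \<subseteq> (\<Union>i\<in>I. S i)" using t by fastforce
        show "inj_on t (I - {i})" using inj_on_transversal[OF t] disjI by blast
        show "p \<notin> t ` (I - {i})" using sub pI by blast
        show "general_position (insert p (t ` (I - {i})))"
          using general_position_subset[OF gpI] sub by blast
      qed
    qed
    then obtain t where t: "t \<in> Pi\<^sub>E (I - {i}) S" "p \<in> convex hull (insert v (t ` (I - {i})))" by blast
    then have "t(i := v) \<in> E" using upd[OF i v] by simp
    then show "\<exists>e\<in>E. e i = v" by (metis fun_upd_same)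
  next
    fix i x y t t'
    assume i: "i \<in> I" and x: "x \<in> S i" and y: "y \<in> S i" and "x \<noteq> y"
      and t: "t \<in> Pi\<^sub>E (I - {i}) S" and t': "t' \<in> Pi\<^sub>E (I - {i}) S"
      and tt': "\<And>j. j \<in> I - {i} \<Longrightarrow> t j \<noteq> t' j"
    let ?B = "Pi\<^sub>E (I - {i}) (\<lambda>j. {t j, t' j})"
    have BS: "?B \<subseteq> Pi\<^sub>E (I - {i}) S" using t t' by (intro PiE_mono) auto
    have lk: "link I S E i v \<inter> ?B = {s \<in> ?B. p \<in> convex hull (insert v (s ` (I - {i})))}"
      if "v \<in> S i" for v
      using upd[OF i that] BS unfolding link_def by blast
    have sub: "{x, y} \<union> (\<Union>j\<in>I - {i}. S j) \<subseteq> (\<Union>j\<in>I. S j)" using x y i by blast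
    show "even (card (link I S E i x \<inter> ?B) + card (link I S E i y \<inter> ?B))"
      unfolding lk[OF x] lk[OF y]
    proof (rule octahedron_parity[OF fin_minus card_minus[OF i] _ \<open>x \<noteq> y\<close> _ _ _ _ t t' tt'])
      show "S k \<inter> S j = {}" if "k \<in> I - {i}" "j \<in> I - {i}" "k \<noteq> j" for k j
        using disjI that by blast
      show "x \<notin> (\<Union>j\<in>I - {i}. S j)" "y \<notin> (\<Union>j\<in>I - {i}. S j)"
        using disjI[OF i] x y by blast+
      show "p \<notin> {x, y} \<union> (\<Union>j\<in>I - {i}. S j)" using pI sub by blast
      show "general_position (insert p ({x, y} \<union> (\<Union>j\<in>I - {i}. S j)))"
        using gpI by (rule general_position_subset) (use sub in blast)
    qed
  qed
  then have "card I ^ 2 \<le> 2 * card E" by (rule octahedral_system.card_edges)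
  then have "real ((CARD('n) + 1) ^ 2) \<le> real (2 * card E)"
    unfolding card_I by (simp only: of_nat_le_iff)
  then have "real ((CARD('n) + 1) ^ 2) / 2 \<le> real_of_int (int (card E))" by simp
  \<comment> \<open>The count is an integer, so the bound survives rounding up.\<close>
  then have "\<lceil>real ((CARD('n) + 1) ^ 2) / 2\<rceil> \<le> int (card E)" by (rule ceiling_le)
  then show ?thesis unfolding E_def by linarith
qed

end
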